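(* The Vaidya-Bonner-de Sitter spacetime is neither an Einstein manifold of level $2$ nor of Roter type, but (i) it is an Einstein manifold of level $3$ and (ii) it is of generalized Roter type.
   Context: The Vaidya-Bonner-de Sitter (VBdS) spacetime is the $4$-dimensional Lorentzian manifold with coordinates $(x^1,x^2,x^3,x^4)=(t,r,\theta,\phi)$ and metric $ds^2=\left(1-\frac{2m(t)}{r}+\frac{q^2(t)}{r^2}-\frac{\lambda r^2}{3}\right)dt^2-2\,dt\,dr-r^2(d\theta^2+\sin^2\theta\, d\phi^2)$, where $\lambda$ is a constant and the mass $m=m(t)$ and charge $q=q(t)$ are smooth functions depending on $t$. Curvature conventions: $R_{efst}=g_{e\alpha}(\partial_s\Gamma^\alpha_{ft}-\partial_t\Gamma^\alpha_{fs}+\Gamma^\beta_{ft}\Gamma^\alpha_{\beta s}-\Gamma^\beta_{fs}\Gamma^\alpha_{\beta t})$, Ricci tensor $S_{fs}=g^{et}R_{efst}$. For symmetric $(0,2)$ tensors $X,Z$ the Kulkarni-Nomizu product is $(X\wedge Z)_{efst}=X_{et}Z_{fs}+X_{fs}Z_{et}-X_{es}Z_{ft}-X_{ft}Z_{es}$. Let $J$ be the $(1,1)$ Ricci operator and $S^i(X,Y)=S^{i-1}(JX,Y)$ for $i\ge2$, $S^1=S$. The manifold is an Einstein manifold of level $k$ (Ein$(k)$) if $g,S,S^2,\dots,S^k$ are linearly dependent. It is of generalized Roter type if $R=\mathscr R_{11}\,g\wedge g+\mathscr R_{12}\,g\wedge S+\mathscr R_{22}\,S\wedge S+\mathscr R_{13}\,g\wedge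 S^2+\mathscr R_{23}\,S\wedge S^2+\mathscr R_{33}\,S^2\wedge S^2$ for some scalar functions $\mathscr R_{ij}$, and of Roter type if this holds with $\mathscr R_{13}=\mathscr R_{23}=\mathscr R_{33}=0$.
   Formalization: The charge q(t) is assumed to have no zero and m, q are assumed not both constant; otherwise the claim fails (q = 0 or m, q constant gives Einstein of level 2; q vanishing at a point with m nonzero is not of generalized Roter type). *)

theory Defs
  imports "HOL-Analysis.Analysis"
begin

section \<open>Curvature in a coordinate chart\<close>

text \<open>
  A metric on an open set of \<open>real ^ 'n\<close> is given by its matrix of components \<open>g x $ i $ j\<close>;
  all tensors are given by their components in the coordinate frame.
\<close>

definition pd :: "'n::finite \<Rightarrow> (real ^ 'n \<Rightarrow> real) \<Rightarrow> real ^ 'n \<Rightarrow> real" where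
  "pd i f x = deriv (\<lambda>h. f (x + h *\<^sub>R axis i 1)) 0"

text \<open>On an open set \<open>U\<close>, \<open>Ck_on k U f\<close> is membership in the class \<open>C\<^sup>k\<close>.\<close>

primrec Ck_on :: "nat \<Rightarrow> (real ^ 'n::finite) set \<Rightarrow> (real ^ 'n \<Rightarrow> real) \<Rightarrow> bool" where
  "Ck_on 0 U f \<longleftrightarrow> continuous_on U f"
| "Ck_on (Suc k) U f \<longleftrightarrow> f differentiable_on U \<and> (\<forall>i. Ck_on k U (pd i f))"

definition smooth_scalar_on :: "(real ^ 'n::finite) set \<Rightarrow> (real ^ 'n \<Rightarrow> real) \<Rightarrow> bool" where
  "smooth_scalar_on U f \<longleftrightarrow> (\<forall>k. Ck_on k U f)"

definition christoffel ::
  "(real ^ 'n::finite \<Rightarrow> real ^ 'n ^ 'n) \<Rightarrow> 'n \<Rightarrow> 'n \<Rightarrow> 'n \<Rightarrow> real ^ 'n \<Rightarrow> real" where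
  "christoffel g a b c x =
     (\<Sum>d\<in>UNIV. matrix_inv (g x) $ a $ d *
        (pd b (\<lambda>y. g y $ d $ c) x + pd c (\<lambda>y. g y $ d $ b) x - pd d (\<lambda>y. g y $ b $ c) x)) / 2"

definition riemann ::
  "(real ^ 'n::finite \<Rightarrow> real ^ 'n ^ 'n) \<Rightarrow> real ^ 'n \<Rightarrow> 'n \<Rightarrow> 'n \<Rightarrow> 'n \<Rightarrow> 'n \<Rightarrow> real" where
  "riemann g x e f s t =
     (\<Sum>a\<in>UNIV. g x $ e $ a *
        (pd s (christoffel g a f t) x - pd t (christoffel g a f s) x
         + (\<Sum>b\<in>UNIV. christoffel g b f t x * christoffel g a b s x
                     - christoffel g b f s x * christoffel g a b t x)))"

text \<open>
  The contraction is over the first and last index, so for the curvature convention above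
  the round sphere has negative Ricci tensor.
\<close>

definition ricci :: "(real ^ 'n::finite \<Rightarrow> real ^ 'n ^ 'n) \<Rightarrow> real ^ 'n \<Rightarrow> real ^ 'n ^ 'n" where
  "ricci g x = (\<chi> f s. \<Sum>e\<in>UNIV. \<Sum>t\<in>UNIV. matrix_inv (g x) $ e $ t * riemann g x e f s t)"

text \<open>The operator \<open>J\<close> with \<open>g (J X, Y) = S (X, Y)\<close>.\<close>

definition ricci_op :: "(real ^ 'n::finite \<Rightarrow> real ^ 'n ^ 'n) \<Rightarrow> real ^ 'n \<Rightarrow> real ^ 'n ^ 'n" where
  "ricci_op g x = matrix_inv (g x) ** ricci g x"

text \<open>
  Components of \<open>S\<^sup>i (X, Y) = S\<^sup>i\<^sup>-\<^sup>1 (J X, Y)\<close>, where \<open>(J X)\<close> is \<open>ricci_op g x *v X\<close>. The case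
  \<open>i = 0\<close> is the metric, as is usual.
\<close>

fun ricci_pow :: "nat \<Rightarrow> (real ^ 'n::finite \<Rightarrow> real ^ 'n ^ 'n) \<Rightarrow> real ^ 'n \<Rightarrow> real ^ 'n ^ 'n" where
  "ricci_pow 0 g x = g x"
| "ricci_pow (Suc 0) g x = ricci g x"
| "ricci_pow (Suc (Suc i)) g x = transpose (ricci_op g x) ** ricci_pow (Suc i) g x"

definition kulkarni_nomizu ::
  "real ^ 'n::finite ^ 'n \<Rightarrow> real ^ 'n ^ 'n \<Rightarrow> 'n \<Rightarrow> 'n \<Rightarrow> 'n \<Rightarrow> 'n \<Rightarrow> real" where
  "kulkarni_nomizu X Z e f s t =
     X $ e $ t * Z $ f $ s + X $ f $ s * Z $ e $ t - X $ e $ s * Z $ f $ t - X $ f $ t * Z $ e $ s"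


section \<open>Einstein manifolds of level k and Roter type\<close>

text \<open>
  Linear dependence of \<open>g, S, \<dots>, S\<^sup>k\<close> as a family (so repetitions count) at every point, with
  coefficients that may vary from point to point.
\<close>

definition einstein_level ::
  "nat \<Rightarrow> (real ^ 'n::finite) set \<Rightarrow> (real ^ 'n \<Rightarrow> real ^ 'n ^ 'n) \<Rightarrow> bool" where
  "einstein_level k U g \<longleftrightarrow>
     (\<forall>x\<in>U. \<exists>c :: nat \<Rightarrow> real. (\<exists>i\<le>k. c i \<noteq> 0) \<and> (\<Sum>i\<le>k. c i *\<^sub>R ricci_pow i g x) = 0)"

definition generalized_roter_decomposition ::
  "(real ^ 'n::finite) set \<Rightarrow> (real ^ 'n \<Rightarrow> real ^ 'n ^ 'n) \<Rightarrow>
   (real ^ 'n \<Rightarrow> real) \<Rightarrow> (real ^ 'n \<Rightarrow> real) \<Rightarrow> (real ^ 'n \<Rightarrow> real) \<Rightarrow>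
   (real ^ 'n \<Rightarrow> real) \<Rightarrow> (real ^ 'n \<Rightarrow> real) \<Rightarrow> (real ^ 'n \<Rightarrow> real) \<Rightarrow> bool" where
  "generalized_roter_decomposition U g R11 R12 R22 R13 R23 R33 \<longleftrightarrow>
     (\<forall>x\<in>U. \<forall>e f s t.
        riemann g x e f s t =
            R11 x * kulkarni_nomizu (g x) (g x) e f s t
          + R12 x * kulkarni_nomizu (g x) (ricci g x) e f s t
          + R22 x * kulkarni_nomizu (ricci g x) (ricci g x) e f s t
          + R13 x * kulkarni_nomizu (g x) (ricci_pow 2 g x) e f s t
          + R23 x * kulkarni_nomizu (ricci g x) (ricci_pow 2 g x) e f s t
          + R33 x * kulkarni_nomizu (ricci_pow 2 g x) (ricci_pow 2 g x) e f s t)"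

definition generalized_roter_type ::
  "(real ^ 'n::finite) set \<Rightarrow> (real ^ 'n \<Rightarrow> real ^ 'n ^ 'n) \<Rightarrow> bool" where
  "generalized_roter_type U g \<longleftrightarrow>
     (\<exists>R11 R12 R22 R13 R23 R33.
        smooth_scalar_on U R11 \<and> smooth_scalar_on U R12 \<and> smooth_scalar_on U R22 \<and>
        smooth_scalar_on U R13 \<and> smooth_scalar_on U R23 \<and> smooth_scalar_on U R33 \<and>
        generalized_roter_decomposition U g R11 R12 R22 R13 R23 R33)"

definition roter_type ::
  "(real ^ 'n::finite) set \<Rightarrow> (real ^ 'n \<Rightarrow> real ^ 'n ^ 'n) \<Rightarrow> bool" where
  "roter_type U g \<longleftrightarrow>
     (\<exists>R11 R12 R22.
        smooth_scalar_on U R11 \<and> smooth_scalar_on U R12 \<and> smooth_scalar_on U R22 \<and>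
        generalized_roter_decomposition U g R11 R12 R22 (\<lambda>_. 0) (\<lambda>_. 0) (\<lambda>_. 0))"


section \<open>The Vaidya-Bonner-de Sitter spacetime\<close>

definition smooth_fun_on :: "real set \<Rightarrow> (real \<Rightarrow> real) \<Rightarrow> bool" where
  "smooth_fun_on T f \<longleftrightarrow> (\<forall>n. (deriv ^^ n) f differentiable_on T)"

text \<open>
  The coordinates \<open>(t, r, \<theta>, \<phi>)\<close> are the components \<open>1, 2, 3, 4\<close> of a vector in \<open>real ^ 4\<close>; the
  time \<open>t\<close> ranges over \<open>T\<close> and \<open>(\<theta>, \<phi>)\<close> over the usual spherical chart.
\<close>

definition vbds_domain :: "real set \<Rightarrow> (real ^ 4) set" where
  "vbds_domain T = {x. x $ 1 \<in> T \<and> 0 < x $ 2 \<and> 0 < x $ 3 \<and> x $ 3 < pi \<and> 0 < x $ 4 \<and> x $ 4 < 2 * pi}"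

text \<open>The term \<open>- 2 dt dr\<close> of the line element contributes \<open>- 1\<close> to each of the entries (1,2), (2,1).\<close>

definition vbds_metric ::
  "real \<Rightarrow> (real \<Rightarrow> real) \<Rightarrow> (real \<Rightarrow> real) \<Rightarrow> real ^ 4 \<Rightarrow> real ^ 4 ^ 4" where
  "vbds_metric \<Lambda> m q x =
     (let t = x $ 1; r = x $ 2; \<theta> = x $ 3 in
      vector
       [vector [1 - 2 * m t / r + (q t)\<^sup>2 / r\<^sup>2 - \<Lambda> * r\<^sup>2 / 3, - 1, 0, 0],
        vector [- 1, 0, 0, 0],
        vector [0, 0, - r\<^sup>2, 0],
        vector [0, 0, 0, - (r\<^sup>2 * (sin \<theta>)\<^sup>2)]])"

end

theory Submission
  imports Defs
begin

text \<open>
  Every tensor that occurs is a pointwise combination \<open>u g\<^sub>0 + v g\<^sub>1 + w dt\<^sup>2\<close>, where \<open>g\<^sub>0\<close> and \<open>g\<^sub>1\<close> are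
  the \<open>(t, r)\<close> and the \<open>(\<theta>, \<phi>)\<close> block of \<open>g\<close>. Under \<open>(X, Y) \<mapsto> X g\<^sup>-\<^sup>1 Y\<close> these multiply like
  pairs consisting of a dual number \<open>u + w \<epsilon>\<close> and a scalar \<open>v\<close>. The Ricci tensor is
  \<open>\<alpha> g\<^sub>0 + \<beta> g\<^sub>1 + \<mu> dt\<^sup>2\<close>, so its operator is annihilated by \<open>(X - \<alpha>)\<^sup>2 (X - \<beta>)\<close>, and by no quadratic
  polynomial at a point where \<open>\<mu> \<noteq> 0\<close> and \<open>\<alpha> \<noteq> \<beta>\<close>.

  The curvature is a combination of \<open>g\<^sub>0 \<and> g\<^sub>0\<close>, \<open>g\<^sub>0 \<and> g\<^sub>1\<close>, \<open>g\<^sub>1 \<and> g\<^sub>1\<close> and \<open>dt\<^sup>2 \<and> g\<^sub>1\<close>, which are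
  linearly independent. Comparing coefficients gives four equations. With \<open>\<R>\<^sub>2\<^sub>3 = \<R>\<^sub>3\<^sub>3 = 0\<close> they have a
  solution in which the factor \<open>\<mu>\<close> has cancelled, so that it stays smooth where \<open>\<mu>\<close> vanishes; it has
  \<open>\<R>\<^sub>1\<^sub>3 = \<R>\<^sub>2\<^sub>2\<close>, a multiple of \<open>m r - q\<^sup>2\<close>. With \<open>\<R>\<^sub>1\<^sub>3 = 0\<close> as well, they force \<open>m r = q\<^sup>2\<close> wherever
  \<open>\<mu> \<noteq> 0\<close>, which fails for suitable \<open>r\<close>.
\<close>

section \<open>Spherically symmetric tensors\<close>

lemma vector_4 [simp]:
  "(vector [w, x, y, z] :: 'a::zero ^ 4) $ 1 = w"
  "(vector [w, x, y, z] :: 'a::zero ^ 4) $ 2 = x"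
  "(vector [w, x, y, z] :: 'a::zero ^ 4) $ 3 = y"
  "(vector [w, x, y, z] :: 'a::zero ^ 4) $ 4 = z"
  unfolding vector_def by auto

text \<open>\<open>f\<close> is the component \<open>g\<^sub>1\<^sub>1\<close>, so that \<open>spherical_tensor f x 1 1 0\<close> is the metric.\<close>

definition spherical_tensor :: "real \<Rightarrow> real ^ 4 \<Rightarrow> real \<Rightarrow> real \<Rightarrow> real \<Rightarrow> real ^ 4 ^ 4" where
  "spherical_tensor f x u v w =
     vector
       [vector [u * f + w, - u, 0, 0],
        vector [- u, 0, 0, 0],
        vector [0, 0, - (v * (x $ 2)\<^sup>2), 0],
        vector [0, 0, 0, - (v * ((x $ 2)\<^sup>2 * (sin (x $ 3))\<^sup>2))]]"

lemma spherical_tensor_rows: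
  "spherical_tensor f x u v w $ 1 = vector [u * f + w, - u, 0, 0]"
  "spherical_tensor f x u v w $ 2 = vector [- u, 0, 0, 0]"
  "spherical_tensor f x u v w $ 3 = vector [0, 0, - (v * (x $ 2)\<^sup>2), 0]"
  "spherical_tensor f x u v w $ 4 = vector [0, 0, 0, - (v * ((x $ 2)\<^sup>2 * (sin (x $ 3))\<^sup>2))]"
  by (simp_all add: spherical_tensor_def)

lemma spherical_tensor_add:
  "spherical_tensor f x u v w + spherical_tensor f x u' v' w'
     = spherical_tensor f x (u + u') (v + v') (w + w')"
  by (simp add: vec_eq_iff forall_4 spherical_tensor_def algebra_simps)

lemma spherical_tensor_scaleR:
  "c *\<^sub>R spherical_tensor f x u v w = spherical_tensor f x (c * u) (c * v) (c * w)"
  by (simp add: vec_eq_iff forall_4 spherical_tensor_def algebra_simps)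

lemma spherical_tensor_eq_0:
  assumes "x $ 2 \<noteq> 0" "spherical_tensor f x u v w = 0"
  shows "u = 0" "v = 0" "w = 0"
  using assms by (auto simp add: vec_eq_iff forall_4 spherical_tensor_def)

lemma matrix_inv_eqI:
  fixes A :: "'a::semiring_1 ^ 'n ^ 'm" and B :: "'a ^ 'm ^ 'n"
  assumes "A ** B = mat 1" "B ** A = mat 1"
  shows "matrix_inv A = B"
proof -
  have "A ** matrix_inv A = mat 1 \<and> matrix_inv A ** A = mat 1"
    unfolding matrix_inv_def by (rule someI[of _ B]) (use assms in auto)
  then have "(matrix_inv A ** A) ** B = B" by simp
  then show ?thesis by (simp add: matrix_mul_assoc [symmetric] assms)
qed

lemma matrix_inv_spherical_tensor:
  assumes "x $ 2 \<noteq> 0" "sin (x $ 3) \<noteq> 0"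
  shows "matrix_inv (spherical_tensor f x 1 1 0) =
    vector
       [vector [0, - 1, 0, 0],
        vector [- 1, - f, 0, 0],
        vector [0, 0, - 1 / (x $ 2)\<^sup>2, 0],
        vector [0, 0, 0, - 1 / ((x $ 2)\<^sup>2 * (sin (x $ 3))\<^sup>2)]]"
  using assms
  by (intro matrix_inv_eqI)
     (simp_all add: vec_eq_iff forall_4 spherical_tensor_def matrix_matrix_mult_def sum_4 mat_def)

text \<open>The transpose matches the recursion of \<open>ricci_pow\<close>. There is no
  \<open>w * w'\<close> term because the (1,1) entry of the inverse metric is zero, so
  \<open>dt^2\<close> is nilpotent under this product.\<close>

lemma spherical_tensor_compose:
  assumes "x $ 2 \<noteq> 0" "sin (x $ 3) \<noteq> 0"
  shows "transpose (matrix_inv (spherical_tensor f x 1 1 0) ** spherical_tensor f x u v w)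
           ** spherical_tensor f x u' v' w' =
         spherical_tensor f x (u * u') (v * v') (u * w' + w * u')"
  unfolding matrix_inv_spherical_tensor[OF assms]
  using assms
  by (simp add: vec_eq_iff forall_4 spherical_tensor_def matrix_matrix_mult_def sum_4
        transpose_def field_simps)

lemma sum_atMost_2: "(\<Sum>i\<le>2. f i) = f 0 + f 1 + f (2::nat)"
  and sum_atMost_3: "(\<Sum>i\<le>3. f i) = f 0 + f 1 + f 2 + f (3::nat)"
  for f :: "nat \<Rightarrow> 'a::comm_monoid_add"
  by (simp_all add: numeral_2_eq_2 numeral_3_eq_3 add.assoc)

text \<open>Exchanging \<open>s\<close> and \<open>t\<close> exchanges the terms of the defining
  formula in pairs, so this is pure algebra. It halves the components that have to be
  computed.\<close>

lemma riemann_swap: "riemann g x e f t s = - riemann g x e f s t"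
  unfolding riemann_def by (simp add: sum_negf [symmetric] sum_subtractf algebra_simps)

lemma kulkarni_nomizu_swap: "kulkarni_nomizu X Z e f t s = - kulkarni_nomizu X Z e f s t"
  by (simp add: kulkarni_nomizu_def)

section \<open>Curvature of generalized Vaidya metrics\<close>

lemma pd_eqI:
  assumes "((\<lambda>h. f (x + h *\<^sub>R axis i 1)) has_real_derivative D) (at 0)"
  shows "pd i f x = D"
  unfolding pd_def using assms by (rule DERIV_imp_deriv)

lemma DERIV_at_0_shift:
  "(f has_real_derivative D) (at a) \<Longrightarrow> ((\<lambda>h. f (a + h)) has_real_derivative D) (at 0)"
  using DERIV_shift[of f D 0 a] by (simp add: add.commute)

lemma pd_const [simp]: "pd i (\<lambda>y. c) x = 0"
  by (rule pd_eqI) auto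

text \<open>Closed forms such as that of the connection hold only on the chart. Openness keeps the
  line \<open>x + h e_i\<close> inside \<open>U\<close> for small \<open>h\<close>, so equality on
  \<open>U\<close> suffices to differentiate them.\<close>

lemma pd_cong:
  assumes "open U" "x \<in> U" "\<And>y. y \<in> U \<Longrightarrow> f y = g y"
  shows "pd i f x = pd i g x"
proof -
  have "((\<lambda>h. x + h *\<^sub>R axis i 1) \<longlongrightarrow> x + 0 *\<^sub>R axis i 1) (nhds (0::real))"
    by (intro tendsto_intros filterlim_ident)
  then have "\<forall>\<^sub>F h in nhds (0::real). x + h *\<^sub>R axis i 1 \<in> U"
    using assms(1,2) by (auto simp: tendsto_def)
  then have "\<forall>\<^sub>F h in nhds 0. f (x + h *\<^sub>R axis i 1) = g (x + h *\<^sub>R axis i 1)"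
    by eventually_elim (rule assms(3))
  then show ?thesis unfolding pd_def by (rule deriv_cong_ev) simp
qed

lemma open_vbds_domain:
  assumes "open T"
  shows "open (vbds_domain T)"
proof -
  let ?S = "{x::real^4. 0 < x $ 2 \<and> 0 < x $ 3 \<and> x $ 3 < pi \<and> 0 < x $ 4 \<and> x $ 4 < 2 * pi}"
  have "open ((\<lambda>x::real^4. x $ 1) -` T)"
    using assms by (intro open_vimage continuous_intros)
  moreover have "open ?S"
    by (intro open_Collect_conj open_Collect_less continuous_intros)
  ultimately have "open ((\<lambda>x::real^4. x $ 1) -` T \<inter> ?S)"
    by blast
  moreover have "vbds_domain T = (\<lambda>x. x $ 1) -` T \<inter> ?S"
    by (auto simp: vbds_domain_def)
  ultimately show ?thesis by simp
qed

text \<open>\<open>F\<close> is the component \<open>g_11\<close>, and its derivatives are named so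
  that curvature becomes algebra in these symbols. One function \<open>Ftr\<close> serves both
  orders of mixed differentiation, which makes the mixed terms cancel in the curvature.\<close>

locale generalized_vaidya =
  fixes F Ft Fr Ftr Frr :: "real \<Rightarrow> real \<Rightarrow> real" and T :: "real set"
  assumes open_T: "open T"
    and F_t: "\<And>t r. t \<in> T \<Longrightarrow> 0 < r \<Longrightarrow> ((\<lambda>t. F t r) has_real_derivative Ft t r) (at t)"
    and F_r: "\<And>t r. t \<in> T \<Longrightarrow> 0 < r \<Longrightarrow> ((\<lambda>r. F t r) has_real_derivative Fr t r) (at r)"
    and Ft_r: "\<And>t r. t \<in> T \<Longrightarrow> 0 < r \<Longrightarrow> ((\<lambda>r. Ft t r) has_real_derivative Ftr t r) (at r)"
    and Fr_t: "\<And>t r. t \<in> T \<Longrightarrow> 0 < r \<Longrightarrow> ((\<lambda>t. Fr t r) has_real_derivative Ftr t r) (at t)"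
    and Fr_r: "\<And>t r. t \<in> T \<Longrightarrow> 0 < r \<Longrightarrow> ((\<lambda>r. Fr t r) has_real_derivative Frr t r) (at r)"
begin

abbreviation tensor :: "real \<Rightarrow> real \<Rightarrow> real \<Rightarrow> real ^ 4 \<Rightarrow> real ^ 4 ^ 4" where
  "tensor u v w x \<equiv> spherical_tensor (F (x $ 1) (x $ 2)) x u v w"

abbreviation metric :: "real ^ 4 \<Rightarrow> real ^ 4 ^ 4" where
  "metric \<equiv> tensor 1 1 0"

text \<open>The table of Christoffel symbols of \<open>metric\<close>, upper index first.\<close>

definition connection :: "real ^ 4 \<Rightarrow> real ^ 4 ^ 4 ^ 4" where
  "connection x =
     (let f = F (x $ 1) (x $ 2); ft = Ft (x $ 1) (x $ 2); fr = Fr (x $ 1) (x $ 2);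
          r = x $ 2; s = sin (x $ 3); c = cos (x $ 3) in
      vector
       [vector [vector [fr / 2, 0, 0, 0], vector [0, 0, 0, 0],
                vector [0, 0, - r, 0], vector [0, 0, 0, - (r * s\<^sup>2)]],
        vector [vector [(f * fr - ft) / 2, - (fr / 2), 0, 0], vector [- (fr / 2), 0, 0, 0],
                vector [0, 0, - (f * r), 0], vector [0, 0, 0, - (f * r * s\<^sup>2)]],
        vector [vector [0, 0, 0, 0], vector [0, 0, 1 / r, 0],
                vector [0, 1 / r, 0, 0], vector [0, 0, 0, - (s * c)]],
        vector [vector [0, 0, 0, 0], vector [0, 0, 0, 1 / r],
                vector [0, 0, 0, c / s], vector [0, 1 / r, c / s, 0]]])"

lemma connection_rows:
  "connection x $ 1 $ 1 = vector [Fr (x $ 1) (x $ 2) / 2, 0, 0, 0]"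
  "connection x $ 1 $ 2 = vector [0, 0, 0, 0]"
  "connection x $ 1 $ 3 = vector [0, 0, - (x $ 2), 0]"
  "connection x $ 1 $ 4 = vector [0, 0, 0, - (x $ 2 * (sin (x $ 3))\<^sup>2)]"
  "connection x $ 2 $ 1 =
     vector [(F (x $ 1) (x $ 2) * Fr (x $ 1) (x $ 2) - Ft (x $ 1) (x $ 2)) / 2, - (Fr (x $ 1) (x $ 2) / 2), 0, 0]"
  "connection x $ 2 $ 2 = vector [- (Fr (x $ 1) (x $ 2) / 2), 0, 0, 0]"
  "connection x $ 2 $ 3 = vector [0, 0, - (F (x $ 1) (x $ 2) * x $ 2), 0]"
  "connection x $ 2 $ 4 = vector [0, 0, 0, - (F (x $ 1) (x $ 2) * x $ 2 * (sin (x $ 3))\<^sup>2)]"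
  "connection x $ 3 $ 1 = vector [0, 0, 0, 0]"
  "connection x $ 3 $ 2 = vector [0, 0, 1 / x $ 2, 0]"
  "connection x $ 3 $ 3 = vector [0, 1 / x $ 2, 0, 0]"
  "connection x $ 3 $ 4 = vector [0, 0, 0, - (sin (x $ 3) * cos (x $ 3))]"
  "connection x $ 4 $ 1 = vector [0, 0, 0, 0]"
  "connection x $ 4 $ 2 = vector [0, 0, 0, 1 / x $ 2]"
  "connection x $ 4 $ 3 = vector [0, 0, 0, cos (x $ 3) / sin (x $ 3)]"
  "connection x $ 4 $ 4 = vector [0, 1 / x $ 2, cos (x $ 3) / sin (x $ 3), 0]"
  by (simp_all add: connection_def Let_def)

context
  fixes x :: "real ^ 4"
  assumes x: "x \<in> vbds_domain T"
begin

lemma coord: "x $ 1 \<in> T" "0 < x $ 2" "x $ 2 \<noteq> 0" "0 < sin (x $ 3)" "sin (x $ 3) \<noteq> 0"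
  using x sin_gt_zero[of "x $ 3"] by (auto simp: vbds_domain_def)

lemma shift_derivs:
  "((\<lambda>h. F (x $ 1 + h) (x $ 2)) has_real_derivative Ft (x $ 1) (x $ 2)) (at 0)"
  "((\<lambda>h. F (x $ 1) (x $ 2 + h)) has_real_derivative Fr (x $ 1) (x $ 2)) (at 0)"
  "((\<lambda>h. Ft (x $ 1) (x $ 2 + h)) has_real_derivative Ftr (x $ 1) (x $ 2)) (at 0)"
  "((\<lambda>h. Fr (x $ 1 + h) (x $ 2)) has_real_derivative Ftr (x $ 1) (x $ 2)) (at 0)"
  "((\<lambda>h. Fr (x $ 1) (x $ 2 + h)) has_real_derivative Frr (x $ 1) (x $ 2)) (at 0)"
  by (intro DERIV_at_0_shift F_t F_r Ft_r Fr_t Fr_r coord)+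

lemma pd_metric:
  "pd k (\<lambda>y. F (y $ 1) (y $ 2)) x = vector [Ft (x $ 1) (x $ 2), Fr (x $ 1) (x $ 2), 0, 0] $ k"
  "pd k (\<lambda>y. - (y $ 2)\<^sup>2) x = vector [0, - (2 * x $ 2), 0, 0] $ k"
  "pd k (\<lambda>y. - ((y $ 2)\<^sup>2 * (sin (y $ 3))\<^sup>2)) x =
     vector [0, - (2 * x $ 2 * (sin (x $ 3))\<^sup>2), - (2 * (x $ 2)\<^sup>2 * sin (x $ 3) * cos (x $ 3)), 0] $ k"
  using exhaust_4[of k]
  by - (elim disjE; hypsubst; intro pd_eqI; simp add: axis_def;
      ((rule shift_derivs derivative_eq_intros refl)+; simp))+

lemma christoffel_metric: "christoffel metric a b c x = connection x $ a $ b $ c"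
  unfolding christoffel_def matrix_inv_spherical_tensor[OF coord(3,5)]
  using exhaust_4[of a] exhaust_4[of b] exhaust_4[of c]
  by (elim disjE; hypsubst; simp add: sum_4 spherical_tensor_def pd_metric connection_def Let_def coord)
     (simp_all add: power2_eq_square coord)

end

section \<open>Riemann and Ricci tensors in block form\<close>

definition rho1 :: "real ^ 4 \<Rightarrow> real" where "rho1 x = - Frr (x $ 1) (x $ 2) / 2"
definition rho2 :: "real ^ 4 \<Rightarrow> real" where "rho2 x = - Fr (x $ 1) (x $ 2) / (2 * x $ 2)"
definition rho3 :: "real ^ 4 \<Rightarrow> real" where "rho3 x = (1 - F (x $ 1) (x $ 2)) / (x $ 2)\<^sup>2"
definition alpha :: "real ^ 4 \<Rightarrow> real" where "alpha x = rho1 x + 2 * rho2 x"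
definition beta :: "real ^ 4 \<Rightarrow> real" where "beta x = 2 * rho2 x + rho3 x"
definition kappa :: "real ^ 4 \<Rightarrow> real" where "kappa x = Ft (x $ 1) (x $ 2) / (2 * x $ 2)"

text \<open>The arguments \<open>tensor 1 0 0\<close>, \<open>tensor 0 1 0\<close> and
  \<open>tensor 0 0 1\<close> are the two blocks of the metric and \<open>dt^2\<close>. The halves
  are chosen so that \<open>rho1 = rho2 = rho3\<close> with \<open>kappa = 0\<close> is the constant
  curvature form, a multiple of \<open>g \<and> g\<close>.\<close>

definition curvature where
  "curvature x e f s t =
     rho1 x / 2 * kulkarni_nomizu (tensor 1 0 0 x) (tensor 1 0 0 x) e f s t
     + rho2 x * kulkarni_nomizu (tensor 1 0 0 x) (tensor 0 1 0 x) e f s t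
     + rho3 x / 2 * kulkarni_nomizu (tensor 0 1 0 x) (tensor 0 1 0 x) e f s t
     + kappa x * kulkarni_nomizu (tensor 0 0 1 x) (tensor 0 1 0 x) e f s t"

lemma curvature_swap: "curvature x e f t s = - curvature x e f s t"
  by (simp add: curvature_def kulkarni_nomizu_swap[of _ _ e f t s])

context
  fixes x :: "real ^ 4"
  assumes x: "x \<in> vbds_domain T"
begin

lemma pd_christoffel:
  "pd k (christoffel metric a b c) x = pd k (\<lambda>y. connection y $ a $ b $ c) x"
  by (rule pd_cong[OF open_vbds_domain[OF open_T] x]) (rule christoffel_metric)

text \<open>The condition \<open>k \<noteq> 1\<close> occurs because that symbol contains
  \<open>Ft\<close>, whose derivative in \<open>t\<close> is not given. For \<open>s < t\<close> the
  curvature never asks for it.\<close>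

lemma pd_connection:
  "pd k (\<lambda>y. Fr (y $ 1) (y $ 2) / 2) x = vector [Ftr (x $ 1) (x $ 2) / 2, Frr (x $ 1) (x $ 2) / 2, 0, 0] $ k"
  "pd k (\<lambda>y. - (Fr (y $ 1) (y $ 2) / 2)) x = vector [- Ftr (x $ 1) (x $ 2) / 2, - Frr (x $ 1) (x $ 2) / 2, 0, 0] $ k"
  "k \<noteq> 1 \<Longrightarrow> pd k (\<lambda>y. (F (y $ 1) (y $ 2) * Fr (y $ 1) (y $ 2) - Ft (y $ 1) (y $ 2)) / 2) x =
     vector [0, ((Fr (x $ 1) (x $ 2))\<^sup>2 + F (x $ 1) (x $ 2) * Frr (x $ 1) (x $ 2) - Ftr (x $ 1) (x $ 2)) / 2, 0, 0] $ k"
  "pd k (\<lambda>y. - (F (y $ 1) (y $ 2) * y $ 2)) x =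
     vector [- (Ft (x $ 1) (x $ 2) * x $ 2), - (Fr (x $ 1) (x $ 2) * x $ 2 + F (x $ 1) (x $ 2)), 0, 0] $ k"
  "pd k (\<lambda>y. - (F (y $ 1) (y $ 2) * y $ 2 * (sin (y $ 3))\<^sup>2)) x =
     vector [- (Ft (x $ 1) (x $ 2) * x $ 2 * (sin (x $ 3))\<^sup>2),
             - ((Fr (x $ 1) (x $ 2) * x $ 2 + F (x $ 1) (x $ 2)) * (sin (x $ 3))\<^sup>2),
             - (2 * F (x $ 1) (x $ 2) * x $ 2 * sin (x $ 3) * cos (x $ 3)), 0] $ k"
  "pd k (\<lambda>y. - (y $ 2)) x = vector [0, - 1, 0, 0] $ k"
  "pd k (\<lambda>y. - (y $ 2 * (sin (y $ 3))\<^sup>2)) x =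
     vector [0, - (sin (x $ 3))\<^sup>2, - (2 * x $ 2 * sin (x $ 3) * cos (x $ 3)), 0] $ k"
  "pd k (\<lambda>y. 1 / y $ 2) x = vector [0, - 1 / (x $ 2)\<^sup>2, 0, 0] $ k"
  "pd k (\<lambda>y. - (sin (y $ 3) * cos (y $ 3))) x = vector [0, 0, (sin (x $ 3))\<^sup>2 - (cos (x $ 3))\<^sup>2, 0] $ k"
  "pd k (\<lambda>y. cos (y $ 3) / sin (y $ 3)) x = vector [0, 0, - 1 - (cos (x $ 3) / sin (x $ 3))\<^sup>2, 0] $ k"
  using exhaust_4[of k] coord[OF x]
  by - (elim disjE; hypsubst; (simp; fail)?; rule pd_eqI; simp add: axis_def;
      ((rule shift_derivs[OF x] derivative_eq_intros refl | (simp; fail))+)?;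
      simp add: field_simps power2_eq_square)+

text \<open>
  For \<open>s = t = 1\<close> the definition contains the second \<open>t\<close>-derivative of \<open>F\<close>, which need not exist in
  this locale. Hence only pairs \<open>s < t\<close> are computed; the rest follows from antisymmetry.
\<close>

lemma riemann_metric_less:
  assumes "s = 1 \<and> t = 2 \<or> s = 1 \<and> t = 3 \<or> s = 1 \<and> t = 4 \<or> s = 2 \<and> t = 3 \<or> s = 2 \<and> t = 4 \<or> s = 3 \<and> t = 4"
  shows "riemann metric x e f s t = curvature x e f s t"
  using assms exhaust_4[of e] exhaust_4[of f]
  unfolding riemann_def pd_christoffel christoffel_metric[OF x]
  by (elim disjE; hypsubst?; elim conjE; hypsubst; simp add: pd_connection sum_4 curvature_def
        kulkarni_nomizu_def spherical_tensor_rows connection_rows coord[OF x])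
     (simp_all add: rho1_def rho2_def rho3_def kappa_def coord[OF x] power2_eq_square,
      simp_all add: field_simps coord[OF x] power4_eq_xxxx)

lemma riemann_metric: "riemann metric x e f s t = curvature x e f s t"
proof -
  consider "s = t"
    | "s = 1 \<and> t = 2 \<or> s = 1 \<and> t = 3 \<or> s = 1 \<and> t = 4 \<or> s = 2 \<and> t = 3 \<or> s = 2 \<and> t = 4 \<or> s = 3 \<and> t = 4"
    | "t = 1 \<and> s = 2 \<or> t = 1 \<and> s = 3 \<or> t = 1 \<and> s = 4 \<or> t = 2 \<and> s = 3 \<or> t = 2 \<and> s = 4 \<or> t = 3 \<and> s = 4"
    using exhaust_4[of s] exhaust_4[of t] by blast
  then show ?thesis
  proof cases
    case 1
    then show ?thesis
      using riemann_swap[of metric x e f s s] curvature_swap[of x e f s s] by simp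
  next
    case 2
    then show ?thesis by (rule riemann_metric_less)
  next
    case 3
    then have "riemann metric x e f t s = curvature x e f t s" by (rule riemann_metric_less)
    then show ?thesis
      by (simp add: riemann_swap[of metric x e f t s] curvature_swap[of x e f t s])
  qed
qed

text \<open>Each block has trace 2. Contracting \<open>dt^2 \<and> g1\<close> therefore gives
  \<open>2 dt^2\<close>, while \<open>dt^2\<close> itself is trace-free; hence the entry
  \<open>2 * kappa x\<close>, which is the \<open>\<mu>\<close> of the overview.\<close>

lemma ricci_metric: "ricci metric x = tensor (alpha x) (beta x) (2 * kappa x) x"
  unfolding ricci_def riemann_metric matrix_inv_spherical_tensor[OF coord(3,5)[OF x]]
  by (simp add: vec_eq_iff forall_4 sum_4 curvature_def kulkarni_nomizu_def spherical_tensor_rows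
      coord[OF x])
     (simp add: alpha_def beta_def field_simps coord[OF x])

text \<open>The last entries are the dual parts of \<open>(alpha + 2 kappa \<epsilon>)^n\<close>,
  namely \<open>2 n alpha^(n-1) kappa\<close>.\<close>

lemma ricci_pow_metric:
  "ricci_pow 0 metric x = tensor 1 1 0 x"
  "ricci_pow 1 metric x = tensor (alpha x) (beta x) (2 * kappa x) x"
  "ricci_pow 2 metric x = tensor ((alpha x)\<^sup>2) ((beta x)\<^sup>2) (4 * alpha x * kappa x) x"
  "ricci_pow 3 metric x = tensor (alpha x ^ 3) (beta x ^ 3) (6 * (alpha x)\<^sup>2 * kappa x) x"
  by (simp_all add: numeral_2_eq_2 numeral_3_eq_3 ricci_op_def ricci_metric
      spherical_tensor_compose[OF coord(3,5)[OF x]] algebra_simps)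

end

section \<open>Linear relations between the powers of the Ricci tensor\<close>

lemma einstein_level_3: "einstein_level 3 (vbds_domain T) metric"
  unfolding einstein_level_def
proof
  fix x assume x: "x \<in> vbds_domain T"
  let ?a = "alpha x" and ?b = "beta x"
  \<comment> \<open>These are the coefficients of \<open>(X - alpha)^2 (X - beta)\<close> in
    increasing degree. The double root also kills the \<open>dt^2\<close> part, which carries the
    derivative of the polynomial at \<open>alpha\<close>.\<close>
  define c :: "nat \<Rightarrow> real" where
    "c = (\<lambda>i. [- (?a\<^sup>2 * ?b), ?a\<^sup>2 + 2 * ?a * ?b, - (2 * ?a + ?b), 1] ! i)"
  have "(\<Sum>i\<le>3. c i *\<^sub>R ricci_pow i metric x) = 0"
    unfolding sum_atMost_3 ricci_pow_metric[OF x] spherical_tensor_add spherical_tensor_scaleR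
    by (simp add: c_def vec_eq_iff forall_4 spherical_tensor_rows algebra_simps power2_eq_square power3_eq_cube)
  moreover have "c 3 \<noteq> 0" by (simp add: c_def)
  ultimately show "\<exists>c :: nat \<Rightarrow> real. (\<exists>i\<le>3. c i \<noteq> 0) \<and> (\<Sum>i\<le>3. c i *\<^sub>R ricci_pow i metric x) = 0"
    by blast
qed

lemma not_einstein_level_2:
  assumes x: "x \<in> vbds_domain T" and "kappa x \<noteq> 0" "rho1 x \<noteq> rho3 x"
  shows "\<not> einstein_level 2 (vbds_domain T) metric"
proof
  assume "einstein_level 2 (vbds_domain T) metric"
  then obtain c :: "nat \<Rightarrow> real" and j where c: "j \<le> 2" "c j \<noteq> 0"
    and "(\<Sum>i\<le>2. c i *\<^sub>R ricci_pow i metric x) = 0"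
    using x unfolding einstein_level_def by blast
  \<comment> \<open>For \<open>p(X) = c 0 + c 1 X + c 2 X^2\<close> the three entries are
    \<open>p(alpha)\<close>, \<open>p(beta)\<close> and \<open>2 kappa p'(alpha)\<close>. A
    polynomial of degree at most 2 with a double root \<open>alpha\<close> and another root
    \<open>beta\<close> is zero.\<close>
  then have "tensor (c 0 + c 1 * alpha x + c 2 * (alpha x)\<^sup>2) (c 0 + c 1 * beta x + c 2 * (beta x)\<^sup>2)
     (c 1 * (2 * kappa x) + c 2 * (4 * alpha x * kappa x)) x = 0"
    unfolding sum_atMost_2 ricci_pow_metric[OF x] spherical_tensor_add spherical_tensor_scaleR by simp
  note * = spherical_tensor_eq_0[OF coord(3)[OF x] this]
  have ab: "alpha x - beta x \<noteq> 0" using assms by (simp add: alpha_def beta_def)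
  have c1: "c 1 = - 2 * alpha x * c 2" using *(3) assms(2) by algebra
  then have "c 2 * (alpha x - beta x)\<^sup>2 = 0" using *(1,2) by algebra
  then have c2: "c 2 = 0" using ab by simp
  with c1 have "c 1 = 0" by simp
  with c2 *(1) have "c 0 = 0" by simp
  moreover have "j = 0 \<or> j = 1 \<or> j = 2" using c(1) by auto
  ultimately show False using c(2) c2 \<open>c 1 = 0\<close> by auto
qed

section \<open>Roter and generalized Roter decompositions\<close>

text \<open>This is bilinearity and symmetry of the product. The products of \<open>dt^2\<close>
  with itself and with the \<open>(t, r)\<close> block drop out: on two indices only the component
  1212 could survive, and it vanishes because \<open>g_22 = 0\<close>.\<close>

lemma kulkarni_nomizu_tensor:
  "kulkarni_nomizu (tensor u v w x) (tensor u' v' w' x) e f s t =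
     u * u' * kulkarni_nomizu (tensor 1 0 0 x) (tensor 1 0 0 x) e f s t
     + (u * v' + v * u') * kulkarni_nomizu (tensor 1 0 0 x) (tensor 0 1 0 x) e f s t
     + v * v' * kulkarni_nomizu (tensor 0 1 0 x) (tensor 0 1 0 x) e f s t
     + (w * v' + v * w') * kulkarni_nomizu (tensor 0 0 1 x) (tensor 0 1 0 x) e f s t"
  using exhaust_4[of e] exhaust_4[of f] exhaust_4[of s] exhaust_4[of t]
  by (elim disjE; hypsubst; simp add: kulkarni_nomizu_def spherical_tensor_rows)
     (simp_all add: algebra_simps)

text \<open>Single components separate the coefficients: 1212 sees only \<open>a\<close>, 3434 only
  \<open>c\<close>, 1323 only \<open>b\<close>. Component 1313 mixes \<open>b\<close> and
  \<open>d\<close>, and so gives \<open>d\<close> once \<open>b\<close> is zero.\<close>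

lemma kulkarni_nomizu_independent:
  assumes x: "x \<in> vbds_domain T"
    and "\<And>e f s t. a * kulkarni_nomizu (tensor 1 0 0 x) (tensor 1 0 0 x) e f s t
       + b * kulkarni_nomizu (tensor 1 0 0 x) (tensor 0 1 0 x) e f s t
       + c * kulkarni_nomizu (tensor 0 1 0 x) (tensor 0 1 0 x) e f s t
       + d * kulkarni_nomizu (tensor 0 0 1 x) (tensor 0 1 0 x) e f s t = 0"
  shows "a = 0" "b = 0" "c = 0" "d = 0"
proof -
  have "c * (2 * (x $ 2) ^ 4 * (sin (x $ 3))\<^sup>2) = 0"
    using assms(2)[of 3 4 3 4]
    by (simp add: kulkarni_nomizu_def spherical_tensor_rows power2_eq_square power4_eq_xxxx mult_ac)
  then show "c = 0" using coord[OF x] by simp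
  show "a = 0" "b = 0" "d = 0"
    using assms(2)[of 1 2 1 2] assms(2)[of 1 3 2 3] assms(2)[of 1 3 1 3]
    by (simp_all add: kulkarni_nomizu_def spherical_tensor_rows coord[OF x])
qed

text \<open>Let \<open>p, q, r\<close> be the coefficients at \<open>x\<close>. Dividing the
  \<open>dt^2\<close> equation by \<open>kappa x\<close> leaves \<open>q + 2 r beta = 1/2\<close>.
  The second equation minus twice the third reads
  \<open>(alpha - beta) (q + 2 r beta) = rho2 - rho3\<close>, and together they force the excluded
  relation.\<close>

lemma not_roter_type:
  assumes x: "x \<in> vbds_domain T" and "kappa x \<noteq> 0" "rho1 x - 2 * rho2 x + rho3 x \<noteq> 0"
  shows "\<not> roter_type (vbds_domain T) metric"
proof
  assume "roter_type (vbds_domain T) metric"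
  then obtain p q r where pqr: "curvature x e f s t = p * kulkarni_nomizu (metric x) (metric x) e f s t
     + q * kulkarni_nomizu (metric x) (ricci metric x) e f s t
     + r * kulkarni_nomizu (ricci metric x) (ricci metric x) e f s t" for e f s t
    using x unfolding roter_type_def generalized_roter_decomposition_def riemann_metric[OF x, symmetric]
    by fastforce
  have "(p + q * alpha x + r * (alpha x)\<^sup>2 - rho1 x / 2)
         * kulkarni_nomizu (tensor 1 0 0 x) (tensor 1 0 0 x) e f s t
     + (2 * p + q * (alpha x + beta x) + 2 * r * alpha x * beta x - rho2 x)
         * kulkarni_nomizu (tensor 1 0 0 x) (tensor 0 1 0 x) e f s t
     + (p + q * beta x + r * (beta x)\<^sup>2 - rho3 x / 2)
         * kulkarni_nomizu (tensor 0 1 0 x) (tensor 0 1 0 x) e f s t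
     + (2 * q * kappa x + 4 * r * beta x * kappa x - kappa x)
         * kulkarni_nomizu (tensor 0 0 1 x) (tensor 0 1 0 x) e f s t = 0" for e f s t
    using pqr[of e f s t] unfolding ricci_metric[OF x] curvature_def
      kulkarni_nomizu_tensor[where u = 1 and v = 1] kulkarni_nomizu_tensor[where u = "alpha x"]
    by (simp add: algebra_simps power2_eq_square)
  note * = kulkarni_nomizu_independent[OF x this]
  have "2 * q + 4 * r * beta x - 1 = 0" using *(4) assms(2) by algebra
  moreover have "alpha x - beta x = rho1 x - rho3 x" by (simp add: alpha_def beta_def)
  ultimately have "rho1 x - 2 * rho2 x + rho3 x = 0" using *(2,3) by algebra
  with assms(3) show False ..
qed

text \<open>The ansatz has \<open>K\<close> as coefficient of both \<open>S \<and> S\<close> and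
  \<open>g \<and> S^2\<close>. The \<open>dt^2\<close> equation, with \<open>kappa\<close>
  cancelled, gives \<open>B\<close>; then the first and third equations both give the same
  \<open>A\<close>, and the second becomes the condition on \<open>K\<close>.\<close>

lemma generalized_roter_decomposition_metric:
  assumes "\<And>x. x \<in> vbds_domain T \<Longrightarrow> 2 * (rho1 x - rho3 x)\<^sup>2 * K x = rho1 x - 2 * rho2 x + rho3 x"
    and "\<And>x. x \<in> vbds_domain T \<Longrightarrow> A x = 2 * alpha x * beta x * K x - rho2 x"
    and "\<And>x. x \<in> vbds_domain T \<Longrightarrow> B x = 1 / 2 - 2 * (alpha x + beta x) * K x"
  shows "generalized_roter_decomposition (vbds_domain T) metric A B K K (\<lambda>_. 0) (\<lambda>_. 0)"
  unfolding generalized_roter_decomposition_def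
proof (intro ballI allI)
  fix x e f s t assume x: "x \<in> vbds_domain T"
  have ab: "alpha x - beta x = rho1 x - rho3 x" "alpha x = rho1 x + 2 * rho2 x"
    by (simp_all add: alpha_def beta_def)
  note K = assms[OF x]
  have coeffs: "rho1 x / 2 = A x + B x * alpha x + K x * (alpha x)\<^sup>2 + K x * (alpha x)\<^sup>2"
    "rho2 x = 2 * A x + B x * (alpha x + beta x) + 2 * K x * alpha x * beta x
      + K x * ((alpha x)\<^sup>2 + (beta x)\<^sup>2)"
    "rho3 x / 2 = A x + B x * beta x + K x * (beta x)\<^sup>2 + K x * (beta x)\<^sup>2"
    using K ab by algebra+
  \<comment> \<open>The factor \<open>z\<close> confines the rewriting to the \<open>dt^2\<close>
    term of the curvature and keeps it from looping, since \<open>kappa x\<close> recurs on the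
    right.\<close>
  have kappa: "kappa x * z = (2 * B x * kappa x + 4 * K x * beta x * kappa x + 4 * K x * alpha x * kappa x) * z" for z
    using K by algebra
  show "riemann metric x e f s t =
            A x * kulkarni_nomizu (metric x) (metric x) e f s t
          + B x * kulkarni_nomizu (metric x) (ricci metric x) e f s t
          + K x * kulkarni_nomizu (ricci metric x) (ricci metric x) e f s t
          + K x * kulkarni_nomizu (metric x) (ricci_pow 2 metric x) e f s t
          + 0 * kulkarni_nomizu (ricci metric x) (ricci_pow 2 metric x) e f s t
          + 0 * kulkarni_nomizu (ricci_pow 2 metric x) (ricci_pow 2 metric x) e f s t"
    unfolding riemann_metric[OF x] curvature_def coeffs
      kappa[of "kulkarni_nomizu (tensor 0 0 1 x) (tensor 0 1 0 x) e f s t"]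
      ricci_metric[OF x] ricci_pow_metric[OF x]
      kulkarni_nomizu_tensor[where u = 1 and v = 1] kulkarni_nomizu_tensor[where u = "alpha x"]
    by (simp add: algebra_simps power2_eq_square)
qed

end

section \<open>Smooth scalar functions\<close>

text \<open>Total differentiability makes the restriction to a coordinate line differentiable, so
  \<open>deriv\<close> takes its true value there and the one-variable rules carry over to
  \<open>pd\<close>.\<close>

lemma has_real_derivative_pd:
  assumes "f differentiable (at x)"
  shows "((\<lambda>h. f (x + h *\<^sub>R axis i 1)) has_real_derivative pd i f x) (at 0)"
proof -
  obtain f' where f': "(f has_derivative f') (at (x + 0 *\<^sub>R axis i 1))"
    using assms by (auto simp: differentiable_def)
  have "((\<lambda>h. x + h *\<^sub>R axis i 1) has_derivative (\<lambda>h. h *\<^sub>R axis i 1)) (at (0::real))"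
    by (auto intro!: derivative_eq_intros)
  from has_derivative_compose[OF this f']
  have "(\<lambda>h. f (x + h *\<^sub>R axis i 1)) differentiable (at 0)"
    by (auto simp: differentiable_def)
  then show ?thesis
    unfolding pd_def using real_differentiable_def DERIV_deriv_iff_real_differentiable by blast
qed

lemma differentiable_on_open_at: "f differentiable_on U \<Longrightarrow> open U \<Longrightarrow> x \<in> U \<Longrightarrow> f differentiable (at x)"
  by (simp add: differentiable_on_eq_differentiable_at)

lemma smooth_fun_on_imp_differentiable_on: "smooth_fun_on T f \<Longrightarrow> f differentiable_on T"
  unfolding smooth_fun_on_def by (drule spec[of _ 0]) simp

lemma smooth_fun_on_deriv: "smooth_fun_on T f \<Longrightarrow> smooth_fun_on T (deriv f)"
  unfolding smooth_fun_on_def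
proof
  fix n assume "\<forall>n. (deriv ^^ n) f differentiable_on T"
  from spec[OF this, of "Suc n"] show "(deriv ^^ n) (deriv f) differentiable_on T"
    by (simp only: funpow_Suc_right o_apply)
qed

lemma pd_add:
  assumes "f differentiable (at x)" "g differentiable (at x)"
  shows "pd i (\<lambda>y. f y + g y) x = pd i f x + pd i g x"
  by (intro pd_eqI DERIV_add has_real_derivative_pd assms)

lemma pd_mult:
  assumes "f differentiable (at x)" "g differentiable (at x)"
  shows "pd i (\<lambda>y. f y * g y) x = f x * pd i g x + pd i f x * g x"
  by (rule pd_eqI, rule DERIV_cong[OF DERIV_mult[OF has_real_derivative_pd[OF assms(1)] has_real_derivative_pd[OF assms(2)]]])
     (simp add: mult.commute)

text \<open>The right-hand side uses only products, a constant and \<open>inverse\<close>, the shape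
  on which the closure rules for \<open>Ck_on\<close> act.\<close>

lemma pd_inverse:
  fixes f :: "real ^ 'n \<Rightarrow> real"
  assumes "f differentiable (at x)" "f x \<noteq> 0"
  shows "pd i (\<lambda>y. inverse (f y)) x = (- 1) * (pd i f x * (inverse (f x) * inverse (f x)))"
  by (rule pd_eqI, rule DERIV_cong[OF DERIV_inverse'[OF has_real_derivative_pd[OF assms(1)]]])
     (use assms(2) in simp_all)

lemma pd_nth: "pd i (\<lambda>y. y $ j) x = axis i 1 $ j"
  by (rule pd_eqI) (auto intro!: derivative_eq_intros)

lemma pd_compose_nth:
  assumes "h differentiable (at (x $ j))"
  shows "pd i (\<lambda>y. h (y $ j)) x = deriv h (x $ j) * axis i 1 $ j"
proof (rule pd_eqI)
  have "(h has_real_derivative deriv h (x $ j)) (at (x $ j + 0 * axis i 1 $ j))"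
    using assms DERIV_deriv_iff_real_differentiable by simp
  moreover have "((\<lambda>t. x $ j + t * axis i 1 $ j) has_real_derivative axis i 1 $ j) (at 0)"
    by (auto intro!: derivative_eq_intros)
  ultimately show "((\<lambda>t. h ((x + t *\<^sub>R axis i 1) $ j)) has_real_derivative
      deriv h (x $ j) * axis i 1 $ j) (at 0)"
    using DERIV_chain2 by fastforce
qed

context
  fixes U :: "(real ^ 'n::finite) set"
  assumes U: "open U"
begin

section \<open>Closure properties of the classes \<open>C^k\<close> on an open set\<close>

text \<open>The product, sum and quotient rules for \<open>pd\<close> are known only at points of
  \<open>U\<close>; this lets them be used inside \<open>Ck_on\<close>.\<close>

lemma Ck_on_cong:
  "Ck_on k U f \<Longrightarrow> (\<And>x. x \<in> U \<Longrightarrow> f x = g x) \<Longrightarrow> Ck_on k U g"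
proof (induction k arbitrary: f g)
  case 0
  have "continuous_on U f = continuous_on U g"
    by (rule continuous_on_cong) (simp_all add: 0)
  with 0 show ?case by simp
next
  case (Suc k)
  have "g differentiable (at x within U)" if "x \<in> U" for x
  proof (rule differentiable_transform_within[where f = f and d = 1])
    show "f differentiable (at x within U)"
      using Suc.prems(1) that by (simp add: differentiable_on_def)
  qed (use that Suc.prems(2) in simp_all)
  then have "g differentiable_on U" by (simp add: differentiable_on_def)
  moreover have "Ck_on k U (pd i g)" for i
  proof (rule Suc.IH)
    show "Ck_on k U (pd i f)" using Suc.prems(1) by simp
    show "pd i f x = pd i g x" if "x \<in> U" for x
      by (rule pd_cong[OF U that]) (rule Suc.prems(2))
  qed
  ultimately show ?case by simp
qed

text \<open>The product rule pairs an undifferentiated factor with a derivative of the other, so the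
  induction for products needs the factors themselves one order lower.\<close>

lemma Ck_on_SucD: "Ck_on (Suc k) U f \<Longrightarrow> Ck_on k U f"
proof (induction k arbitrary: f)
  case 0
  then show ?case by (simp add: differentiable_imp_continuous_on)
next
  case (Suc k)
  from Suc.prems have "f differentiable_on U" "\<And>i. Ck_on (Suc k) U (pd i f)" by simp_all
  then show ?case using Suc.IH by simp
qed

lemma Ck_on_const: "Ck_on k U (\<lambda>x. c)"
proof (induction k arbitrary: c)
  case (Suc k)
  have "pd i (\<lambda>x::real^'n. c) = (\<lambda>x. 0)" for i by (rule ext) simp
  then show ?case using Suc.IH by simp
qed simp

lemma Ck_on_nth: "Ck_on k U (\<lambda>x. x $ j)"
proof (cases k)
  case (Suc k)
  then show ?thesis
    by (auto simp: pd_nth[abs_def] intro!: Ck_on_const bounded_linear_imp_differentiable_on bounded_linear_vec_nth)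
qed (simp add: continuous_on_component)

lemma Ck_on_add: "Ck_on k U f \<Longrightarrow> Ck_on k U g \<Longrightarrow> Ck_on k U (\<lambda>x. f x + g x)"
proof (induction k arbitrary: f g)
  case 0
  then show ?case by (simp add: continuous_on_add)
next
  case (Suc k)
  then have D: "Ck_on k U (\<lambda>x. pd i f x + pd i g x)" for i by simp
  have "Ck_on k U (pd i (\<lambda>x. f x + g x))" for i
    by (rule Ck_on_cong[OF D[of i]]) (use Suc.prems in \<open>auto simp: pd_add differentiable_on_open_at[OF _ U]\<close>)
  then show ?case using Suc.prems by simp
qed

lemma Ck_on_mult: "Ck_on k U f \<Longrightarrow> Ck_on k U g \<Longrightarrow> Ck_on k U (\<lambda>x. f x * g x)"
proof (induction k arbitrary: f g)
  case 0
  then show ?case by (simp add: continuous_on_mult)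
next
  case (Suc k)
  have D: "Ck_on k U (\<lambda>x. f x * pd i g x + pd i f x * g x)" for i
    by (rule Ck_on_add[OF Suc.IH[OF Ck_on_SucD[OF Suc.prems(1)]] Suc.IH[OF _ Ck_on_SucD[OF Suc.prems(2)]]])
       (use Suc.prems in simp_all)
  have "Ck_on k U (pd i (\<lambda>x. f x * g x))" for i
    by (rule Ck_on_cong[OF D[of i]]) (use Suc.prems in \<open>auto simp: pd_mult differentiable_on_open_at[OF _ U]\<close>)
  then show ?case using Suc.prems by simp
qed

lemma Ck_on_inverse:
  "Ck_on k U f \<Longrightarrow> (\<And>x. x \<in> U \<Longrightarrow> f x \<noteq> 0) \<Longrightarrow> Ck_on k U (\<lambda>x. inverse (f x))"
proof (induction k)
  case 0
  then show ?case by (simp add: continuous_on_inverse)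
next
  case (Suc k)
  \<comment> \<open>The derivative of \<open>1/f\<close> contains \<open>1/f\<close> again, so its
    regularity at order \<open>k\<close> comes first.\<close>
  have inv: "Ck_on k U (\<lambda>x. inverse (f x))"
    by (rule Suc.IH[OF Ck_on_SucD[OF Suc.prems(1)] Suc.prems(2)])
  have D: "Ck_on k U (\<lambda>x. (- 1) * (pd i f x * (inverse (f x) * inverse (f x))))" for i
    by (rule Ck_on_mult[OF Ck_on_const Ck_on_mult[OF _ Ck_on_mult[OF inv inv]]]) (use Suc.prems(1) in simp)
  have "Ck_on k U (pd i (\<lambda>x. inverse (f x)))" for i
    by (rule Ck_on_cong[OF D[of i]]) (use Suc.prems in \<open>simp add: pd_inverse differentiable_on_open_at[OF _ U]\<close>)
  then show ?case using Suc.prems by (simp add: differentiable_on_inverse)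
qed

lemma Ck_on_compose_nth:
  assumes "open T" "\<And>x. x \<in> U \<Longrightarrow> x $ j \<in> T"
  shows "smooth_fun_on T h \<Longrightarrow> Ck_on k U (\<lambda>x. h (x $ j))"
proof (induction k arbitrary: h)
  case 0
  have "continuous_on T h"
    by (rule differentiable_imp_continuous_on[OF smooth_fun_on_imp_differentiable_on[OF 0]])
  moreover have "(\<lambda>x. x $ j) ` U \<subseteq> T" using assms(2) by blast
  moreover have "continuous_on U (\<lambda>x. x $ j)" by (intro continuous_intros)
  ultimately show ?case using continuous_on_compose2 by fastforce
next
  case (Suc k)
  have h: "h differentiable (at (x $ j))" if "x \<in> U" for x
    using smooth_fun_on_imp_differentiable_on[OF Suc.prems] assms(1) assms(2)[OF that]
    by (rule differentiable_on_open_at)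
  have D: "Ck_on k U (\<lambda>x. deriv h (x $ j) * axis i 1 $ j)" for i
    by (rule Ck_on_mult[OF Suc.IH[OF smooth_fun_on_deriv[OF Suc.prems]] Ck_on_const])
  have "Ck_on k U (pd i (\<lambda>x. h (x $ j)))" for i
    by (rule Ck_on_cong[OF D[of i]]) (simp add: pd_compose_nth h)
  moreover have "(\<lambda>x. h (x $ j)) differentiable (at x)" if "x \<in> U" for x
    using differentiable_chain_at[OF bounded_linear_imp_differentiable[OF bounded_linear_vec_nth] h[OF that]]
    by (simp add: o_def)
  ultimately show ?case by (simp add: differentiable_on_eq_differentiable_at U)
qed

lemma smooth_scalar_on_const: "smooth_scalar_on U (\<lambda>x. c)"
  by (simp add: smooth_scalar_on_def Ck_on_const)

lemma smooth_scalar_on_nth: "smooth_scalar_on U (\<lambda>x. x $ j)"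
  by (simp add: smooth_scalar_on_def Ck_on_nth)

lemma smooth_scalar_on_compose_nth:
  "open T \<Longrightarrow> (\<And>x. x \<in> U \<Longrightarrow> x $ j \<in> T) \<Longrightarrow> smooth_fun_on T h \<Longrightarrow> smooth_scalar_on U (\<lambda>x. h (x $ j))"
  by (simp add: smooth_scalar_on_def Ck_on_compose_nth)

lemma smooth_scalar_on_add:
  "smooth_scalar_on U f \<Longrightarrow> smooth_scalar_on U g \<Longrightarrow> smooth_scalar_on U (\<lambda>x. f x + g x)"
  unfolding smooth_scalar_on_def using Ck_on_add by blast

lemma smooth_scalar_on_mult:
  "smooth_scalar_on U f \<Longrightarrow> smooth_scalar_on U g \<Longrightarrow> smooth_scalar_on U (\<lambda>x. f x * g x)"
  unfolding smooth_scalar_on_def using Ck_on_mult by blast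

lemma smooth_scalar_on_diff:
  assumes "smooth_scalar_on U f" "smooth_scalar_on U g"
  shows "smooth_scalar_on U (\<lambda>x. f x - g x)"
proof -
  have "smooth_scalar_on U (\<lambda>x. f x + (- 1) * g x)"
    by (rule smooth_scalar_on_add[OF assms(1) smooth_scalar_on_mult[OF smooth_scalar_on_const assms(2)]])
  then show ?thesis by simp
qed

lemma smooth_scalar_on_power:
  assumes "smooth_scalar_on U f"
  shows "smooth_scalar_on U (\<lambda>x. f x ^ n)"
proof (induction n)
  case 0
  show ?case unfolding power_0 by (rule smooth_scalar_on_const)
next
  case (Suc n)
  show ?case unfolding power_Suc by (rule smooth_scalar_on_mult[OF assms Suc])
qed

lemma smooth_scalar_on_divide:
  assumes "smooth_scalar_on U f" "smooth_scalar_on U g" "\<And>x. x \<in> U \<Longrightarrow> g x \<noteq> 0"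
  shows "smooth_scalar_on U (\<lambda>x. f x / g x)"
  unfolding divide_inverse
proof (rule smooth_scalar_on_mult[OF assms(1)])
  show "smooth_scalar_on U (\<lambda>x. inverse (g x))"
    using assms(2,3) Ck_on_inverse unfolding smooth_scalar_on_def by blast
qed

lemmas smooth_scalar_intros =
  smooth_scalar_on_const smooth_scalar_on_nth smooth_scalar_on_add
  smooth_scalar_on_mult smooth_scalar_on_diff smooth_scalar_on_power smooth_scalar_on_divide

end

section \<open>The Vaidya-Bonner-de Sitter metric\<close>

context
  fixes \<Lambda> :: real and m q :: "real \<Rightarrow> real"
begin

definition vbds_f where
  "vbds_f t r = 1 - 2 * m t / r + (q t)\<^sup>2 / r\<^sup>2 - \<Lambda> * r\<^sup>2 / 3"
definition vbds_ft where
  "vbds_ft t r = 2 * q t * deriv q t / r\<^sup>2 - 2 * deriv m t / r"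
definition vbds_fr where
  "vbds_fr t r = 2 * m t / r\<^sup>2 - 2 * (q t)\<^sup>2 / r ^ 3 - 2 * \<Lambda> * r / 3"
definition vbds_ftr where
  "vbds_ftr t r = 2 * deriv m t / r\<^sup>2 - 4 * q t * deriv q t / r ^ 3"
definition vbds_frr where
  "vbds_frr t r = 6 * (q t)\<^sup>2 / r ^ 4 - 4 * m t / r ^ 3 - 2 * \<Lambda> / 3"

lemma generalized_vaidya_vbds:
  assumes "open T" "m differentiable_on T" "q differentiable_on T"
  shows "generalized_vaidya vbds_f vbds_ft vbds_fr vbds_ftr vbds_frr T"
proof
  fix t r :: real assume t: "t \<in> T" and r: "0 < r"
  have mq: "(m has_real_derivative deriv m t) (at t)" "(q has_real_derivative deriv q t) (at t)"
    using assms t by (auto simp: differentiable_on_eq_differentiable_at DERIV_deriv_iff_real_differentiable)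
  have r0: "r \<noteq> 0" "r ^ n \<noteq> 0" for n using r by auto
  show "((\<lambda>t. vbds_f t r) has_real_derivative vbds_ft t r) (at t)"
    unfolding vbds_f_def vbds_ft_def
    by ((rule mq derivative_eq_intros refl r0 numeral_neq_zero)+;
        use r in \<open>simp add: field_simps eval_nat_numeral\<close>)
  show "((\<lambda>t. vbds_fr t r) has_real_derivative vbds_ftr t r) (at t)"
    unfolding vbds_fr_def vbds_ftr_def
    by ((rule mq derivative_eq_intros refl r0 numeral_neq_zero)+;
        use r in \<open>simp add: field_simps eval_nat_numeral\<close>)
  show "((\<lambda>r. vbds_f t r) has_real_derivative vbds_fr t r) (at r)"
    unfolding vbds_f_def vbds_fr_def
    by ((rule derivative_eq_intros refl r0 numeral_neq_zero)+;
        use r in \<open>simp add: field_simps eval_nat_numeral\<close>)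
  show "((\<lambda>r. vbds_ft t r) has_real_derivative vbds_ftr t r) (at r)"
    unfolding vbds_ft_def vbds_ftr_def
    by ((rule derivative_eq_intros refl r0 numeral_neq_zero)+;
        use r in \<open>simp add: field_simps eval_nat_numeral\<close>)
  show "((\<lambda>r. vbds_fr t r) has_real_derivative vbds_frr t r) (at r)"
    unfolding vbds_fr_def vbds_frr_def
    by ((rule derivative_eq_intros refl r0 numeral_neq_zero)+;
        use r in \<open>simp add: field_simps eval_nat_numeral\<close>)
qed (fact assms(1))

end

lemma vbds_metric_eq:
  "vbds_metric \<Lambda> m q = (\<lambda>x. spherical_tensor (vbds_f \<Lambda> m q (x $ 1) (x $ 2)) x 1 1 0)"
  by (rule ext) (simp add: vbds_metric_def Let_def spherical_tensor_def vbds_f_def)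

section \<open>Finding a point where the obstructions do not vanish\<close>

lemma constant_on_if_deriv_zero:
  fixes f :: "real \<Rightarrow> real"
  assumes "open T" "connected T" "f differentiable_on T" "\<And>t. t \<in> T \<Longrightarrow> deriv f t = 0"
  shows "f constant_on T"
proof -
  have "(f has_real_derivative 0) (at t)" if "t \<in> T" for t
    using that assms DERIV_deriv_iff_real_differentiable[of f t]
    by (simp add: differentiable_on_eq_differentiable_at)
  then obtain c where "\<And>t. t \<in> T \<Longrightarrow> f t = c"
    using DERIV_zero_connected_constant[OF assms(2,1) finite.emptyI differentiable_imp_continuous_on[OF assms(3)]]
    by auto
  then show ?thesis by (auto simp: constant_on_def)
qed

text \<open>An affine function that is not identically zero has at most one root, so among three
  points one avoids both roots.\<close>

lemma avoid_two_affine_roots: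
  fixes a b c d :: real
  assumes "a \<noteq> 0 \<or> b \<noteq> 0" "c \<noteq> 0 \<or> d \<noteq> 0"
  obtains r where "0 < r" "a * r + b \<noteq> 0" "c * r + d \<noteq> 0"
proof -
  have "\<exists>r\<in>{1, 2, 3}. a * r + b \<noteq> 0 \<and> c * r + d \<noteq> 0"
    using assms by (auto; argo)
  then obtain r where "r \<in> {1, 2, 3}" "a * r + b \<noteq> 0" "c * r + d \<noteq> 0" by blast
  then show ?thesis using that[of r] by auto
qed

theorem proposition3p2:
  fixes \<Lambda> :: real and m q :: "real \<Rightarrow> real" and T :: "real set"
  assumes "open T" and "connected T"
    and "smooth_fun_on T m" and "smooth_fun_on T q"
    and charged: "\<forall>t\<in>T. q t \<noteq> 0"
    and nonstatic: "\<not> (m constant_on T \<and> q constant_on T)"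
  shows "\<not> einstein_level 2 (vbds_domain T) (vbds_metric \<Lambda> m q)
       \<and> \<not> roter_type (vbds_domain T) (vbds_metric \<Lambda> m q)
       \<and> einstein_level 3 (vbds_domain T) (vbds_metric \<Lambda> m q)
       \<and> generalized_roter_type (vbds_domain T) (vbds_metric \<Lambda> m q)"
proof -
  note diff = smooth_fun_on_imp_differentiable_on[OF assms(3)] smooth_fun_on_imp_differentiable_on[OF assms(4)]
  interpret V: generalized_vaidya "vbds_f \<Lambda> m q" "vbds_ft m q" "vbds_fr \<Lambda> m q" "vbds_ftr m q" "vbds_frr \<Lambda> m q" T
    using generalized_vaidya_vbds assms(1) diff by blast
  have dom: "x $ 1 \<in> T" "0 < x $ 2" if "x \<in> vbds_domain T" for x
    using that by (auto simp: vbds_domain_def)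
  have rho: "V.rho1 x = 2 * m (x $ 1) / x $ 2 ^ 3 - 3 * (q (x $ 1))\<^sup>2 / x $ 2 ^ 4 + \<Lambda> / 3"
    "V.rho2 x = (q (x $ 1))\<^sup>2 / x $ 2 ^ 4 - m (x $ 1) / x $ 2 ^ 3 + \<Lambda> / 3"
    "V.rho3 x = 2 * m (x $ 1) / x $ 2 ^ 3 - (q (x $ 1))\<^sup>2 / x $ 2 ^ 4 + \<Lambda> / 3"
    if "x \<in> vbds_domain T" for x
    using dom(2)[OF that]
    by (simp_all add: V.rho1_def V.rho2_def V.rho3_def vbds_f_def vbds_fr_def vbds_frr_def
        field_simps eval_nat_numeral)

  obtain t where t: "t \<in> T" "deriv m t \<noteq> 0 \<or> deriv q t \<noteq> 0"
    using nonstatic constant_on_if_deriv_zero[OF assms(1,2) diff(1)]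
      constant_on_if_deriv_zero[OF assms(1,2) diff(2)] by blast
  \<comment> \<open>These are the coefficients of two affine functions of \<open>r\<close>:
    \<open>r^3 kappa\<close>, and \<open>m r - q^2\<close>, which is proportional to
    \<open>rho1 - 2 rho2 + rho3\<close>. The charge makes both nontrivial.\<close>
  then have "- deriv m t \<noteq> 0 \<or> q t * deriv q t \<noteq> 0" "m t \<noteq> 0 \<or> - (q t)\<^sup>2 \<noteq> 0"
    using charged by auto
  then obtain r where r: "0 < r" "- deriv m t * r + q t * deriv q t \<noteq> 0" "m t * r + - (q t)\<^sup>2 \<noteq> 0"
    by (rule avoid_two_affine_roots)
  define x :: "real ^ 4" where "x = vector [t, r, 1, 1]"
  have x: "x \<in> vbds_domain T"
    using t r pi_gt3 by (simp add: x_def vbds_domain_def)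
  have "V.kappa x = (- deriv m t * r + q t * deriv q t) / r ^ 3"
    using r(1) by (simp add: V.kappa_def x_def vbds_ft_def field_simps eval_nat_numeral)
  then have kappa: "V.kappa x \<noteq> 0" using r by simp
  have "V.rho1 x - V.rho3 x = - 2 * (q t)\<^sup>2 / r ^ 4"
    unfolding rho[OF x] by (simp add: x_def)
  then have "V.rho1 x \<noteq> V.rho3 x" using r charged t by auto
  then have level2: "\<not> einstein_level 2 (vbds_domain T) V.metric"
    using V.not_einstein_level_2[OF x kappa] by simp
  have "V.rho1 x - 2 * V.rho2 x + V.rho3 x = 6 * (m t * r + - (q t)\<^sup>2) / r ^ 4"
    unfolding rho[OF x] using r(1) by (simp add: x_def field_simps eval_nat_numeral)
  then have "V.rho1 x - 2 * V.rho2 x + V.rho3 x \<noteq> 0" using r by simp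
  then have roter: "\<not> roter_type (vbds_domain T) V.metric"
    by (rule V.not_roter_type[OF x kappa])

  \<comment> \<open>\<open>?K\<close> solves the equation for \<open>K\<close> with
    \<open>(rho1 - rho3)^2 = 4 q^4 / r^8\<close> and
    \<open>rho1 - 2 rho2 + rho3 = 6 (m r - q^2) / r^4\<close>. \<open>?A\<close> and
    \<open>?B\<close> follow by inserting the product and the sum of \<open>alpha\<close> and
    \<open>beta\<close>. Only powers of \<open>r\<close> and \<open>q\<close> remain in
    denominators, hence smoothness.\<close>
  let ?K = "\<lambda>x. 3 * x $ 2 ^ 4 * (m (x $ 1) * x $ 2 - (q (x $ 1))\<^sup>2) / (4 * q (x $ 1) ^ 4)"
  let ?A = "\<lambda>x. 2 * (\<Lambda>\<^sup>2 - q (x $ 1) ^ 4 / x $ 2 ^ 8) * ?K x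
    - ((q (x $ 1))\<^sup>2 / x $ 2 ^ 4 - m (x $ 1) / x $ 2 ^ 3 + \<Lambda> / 3)"
  let ?B = "\<lambda>x. 1 / 2 - 4 * \<Lambda> * ?K x"
  have ab: "V.alpha x = \<Lambda> - (q (x $ 1))\<^sup>2 / x $ 2 ^ 4" "V.beta x = \<Lambda> + (q (x $ 1))\<^sup>2 / x $ 2 ^ 4"
    if "x \<in> vbds_domain T" for x
    unfolding V.alpha_def V.beta_def rho[OF that] by simp_all
  have "generalized_roter_decomposition (vbds_domain T) V.metric ?A ?B ?K ?K (\<lambda>_. 0) (\<lambda>_. 0)"
  proof (rule V.generalized_roter_decomposition_metric)
    fix x :: "real ^ 4" assume x: "x \<in> vbds_domain T"
    have nz: "x $ 2 \<noteq> 0" "q (x $ 1) \<noteq> 0" using dom[OF x] charged by auto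
    have "(V.rho1 x - V.rho3 x)\<^sup>2 = 4 * q (x $ 1) ^ 4 / x $ 2 ^ 8"
      unfolding rho[OF x] by (simp add: power_divide)
    then show "2 * (V.rho1 x - V.rho3 x)\<^sup>2 * ?K x = V.rho1 x - 2 * V.rho2 x + V.rho3 x"
      unfolding rho[OF x] using nz by (simp add: field_simps eval_nat_numeral)
    have "V.alpha x * V.beta x = \<Lambda>\<^sup>2 - q (x $ 1) ^ 4 / x $ 2 ^ 8"
      unfolding ab[OF x] using nz by (simp add: field_simps eval_nat_numeral)
    then show "?A x = 2 * V.alpha x * V.beta x * ?K x - V.rho2 x"
      by (simp only: rho[OF x] mult.assoc)
    have "V.alpha x + V.beta x = 2 * \<Lambda>" unfolding ab[OF x] by simp
    then show "?B x = 1 / 2 - 2 * (V.alpha x + V.beta x) * ?K x" by simp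
  qed
  moreover have "smooth_scalar_on (vbds_domain T) ?K" "smooth_scalar_on (vbds_domain T) ?A"
    "smooth_scalar_on (vbds_domain T) ?B" "smooth_scalar_on (vbds_domain T) (\<lambda>_. 0)"
  proof -
    note U = open_vbds_domain[OF assms(1)]
    note mq = smooth_scalar_on_compose_nth[OF U assms(1) dom(1) assms(3)]
      smooth_scalar_on_compose_nth[OF U assms(1) dom(1) assms(4)]
    have nz: "4 * q (x $ 1) ^ 4 \<noteq> 0" "x $ 2 ^ 3 \<noteq> 0" "x $ 2 ^ 4 \<noteq> 0" "x $ 2 ^ 8 \<noteq> 0"
      if "x \<in> vbds_domain T" for x
      using dom[OF that] charged by auto
    show K: "smooth_scalar_on (vbds_domain T) ?K"
      by (rule mq smooth_scalar_intros[OF U] nz | assumption)+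
    show "smooth_scalar_on (vbds_domain T) ?A" "smooth_scalar_on (vbds_domain T) ?B"
      by (rule K mq smooth_scalar_intros[OF U] nz | (simp; fail))+
    show "smooth_scalar_on (vbds_domain T) (\<lambda>_. 0)"
      by (rule smooth_scalar_on_const[OF U])
  qed
  ultimately have "generalized_roter_type (vbds_domain T) V.metric"
    unfolding generalized_roter_type_def by blast
  with level2 roter V.einstein_level_3 show ?thesis
    unfolding vbds_metric_eq by blast
qed

end
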